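(* Let $K$ be an algebraically closed field of characteristic zero and let $G$ be a finite group of order $n$. Every basic invariant of the group algebra $KG$ can be written as $n^{a}\cdot\#\mathrm{Hom}_{Grp}(P,G)$ for some finitely presented group $P$ and some natural number $a$.
   Context: For a finite dimensional semisimple Hopf algebra $H$ over $K$, let $\ell\in H$, $\lambda\in H^*$ be the integrals with $\epsilon(\ell)=\lambda(1)=\dim(H)$ (the characters of the regular representations of $H^*$ and $H$). A basic invariant of $H$ is a scalar in $K$ obtained from $\lambda^{\otimes r}\otimes\ell^{\otimes s}$ ($r,s\ge0$) by repeatedly applying the comultiplications of $H$ and of $H^*$ to tensor factors, permuting the tensor factors of $H$ among themselves and those of $H^*$ among themselves, and pairing factors of $H$ with factors of $H^*$ by evaluation, until a scalar remains. Natural numbers include $0$. *)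

theory Defs
  imports
    "HOL-Computational_Algebra.Polynomial"
    "HOL-Combinatorics.Permutations"
    "HOL-Algebra.Coset"
begin

section \<open>Finite dimensional Hopf algebras in coordinates\<close>

text \<open>
  A finite dimensional Hopf algebra \<open>H\<close> with a chosen basis \<open>(e\<^sub>i)\<close>, \<open>i \<in> basis H\<close>, is
  given by its structure constants:
  \<open>e\<^sub>i e\<^sub>j = \<Sum>k. mulc H i j k e\<^sub>k\<close>, \<open>1 = \<Sum>i. unitc H i e\<^sub>i\<close>,
  \<open>\<Delta> e\<^sub>k = \<Sum>i j. comulc H k i j (e\<^sub>i \<otimes> e\<^sub>j)\<close>, \<open>\<epsilon> e\<^sub>i = counitc H i\<close> and
  \<open>S e\<^sub>i = \<Sum>j. antipc H i j e\<^sub>j\<close>. Constants at indices outside the basis carry no meaning.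
\<close>

record ('i, 'k) hopf =
  basis :: "'i set"
  mulc :: "'i \<Rightarrow> 'i \<Rightarrow> 'i \<Rightarrow> 'k"
  unitc :: "'i \<Rightarrow> 'k"
  comulc :: "'i \<Rightarrow> 'i \<Rightarrow> 'i \<Rightarrow> 'k"
  counitc :: "'i \<Rightarrow> 'k"
  antipc :: "'i \<Rightarrow> 'i \<Rightarrow> 'k"

text \<open>The dual Hopf algebra with respect to the dual basis.\<close>

definition dual :: "('i, 'k) hopf \<Rightarrow> ('i, 'k) hopf" where
  "dual H = \<lparr>basis = basis H,
     mulc = (\<lambda>i j k. comulc H k i j), unitc = counitc H,
     comulc = (\<lambda>k i j. mulc H i j k), counitc = unitc H,
     antipc = (\<lambda>i j. antipc H j i)\<rparr>"

locale fin_dim_algebra =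
  fixes H :: "('i, 'k::field) hopf"
  assumes finite_basis: "finite (basis H)"
    and assoc: "\<lbrakk>i \<in> basis H; j \<in> basis H; k \<in> basis H; t \<in> basis H\<rbrakk> \<Longrightarrow>
      (\<Sum>l\<in>basis H. mulc H i j l * mulc H l k t) = (\<Sum>l\<in>basis H. mulc H j k l * mulc H i l t)"
    and unit_left: "\<lbrakk>i \<in> basis H; t \<in> basis H\<rbrakk> \<Longrightarrow>
      (\<Sum>l\<in>basis H. unitc H l * mulc H l i t) = of_bool (t = i)"
    and unit_right: "\<lbrakk>i \<in> basis H; t \<in> basis H\<rbrakk> \<Longrightarrow>
      (\<Sum>l\<in>basis H. unitc H l * mulc H i l t) = of_bool (t = i)"

text \<open>Coassociativity and the counit laws of \<open>H\<close> are associativity and the unit laws of the dual.\<close>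

locale hopf_algebra = fin_dim_algebra H + coalg: fin_dim_algebra "dual H"
  for H :: "('i, 'k::field) hopf" +
  assumes comul_mul: "\<lbrakk>i \<in> basis H; j \<in> basis H; a \<in> basis H; b \<in> basis H\<rbrakk> \<Longrightarrow>
      (\<Sum>k\<in>basis H. mulc H i j k * comulc H k a b) =
      (\<Sum>p\<in>basis H. \<Sum>q\<in>basis H. \<Sum>r\<in>basis H. \<Sum>s\<in>basis H.
         comulc H i p q * comulc H j r s * mulc H p r a * mulc H q s b)"
    and comul_unit: "\<lbrakk>a \<in> basis H; b \<in> basis H\<rbrakk> \<Longrightarrow>
      (\<Sum>k\<in>basis H. unitc H k * comulc H k a b) = unitc H a * unitc H b"
    and counit_mul: "\<lbrakk>i \<in> basis H; j \<in> basis H\<rbrakk> \<Longrightarrow>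
      (\<Sum>k\<in>basis H. mulc H i j k * counitc H k) = counitc H i * counitc H j"
    and counit_unit: "(\<Sum>k\<in>basis H. unitc H k * counitc H k) = 1"
    and antipode_left: "\<lbrakk>i \<in> basis H; t \<in> basis H\<rbrakk> \<Longrightarrow>
      (\<Sum>p\<in>basis H. \<Sum>q\<in>basis H. \<Sum>r\<in>basis H. comulc H i p q * antipc H p r * mulc H r q t)
        = counitc H i * unitc H t"
    and antipode_right: "\<lbrakk>i \<in> basis H; t \<in> basis H\<rbrakk> \<Longrightarrow>
      (\<Sum>p\<in>basis H. \<Sum>q\<in>basis H. \<Sum>r\<in>basis H. comulc H i p q * antipc H q r * mulc H p r t)
        = counitc H i * unitc H t"


section \<open>Normalised integrals\<close>

text \<open>
  \<open>x\<close> is the coordinate vector of an element of \<open>H\<close>: the conditions are \<open>e\<^sub>i x = \<epsilon>(e\<^sub>i) x = x e\<^sub>i\<close>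
  and \<open>\<epsilon>(x) = dim H\<close>. If \<open>H\<close> is semisimple over a field of characteristic 0, there is exactly
  one such \<open>x\<close> among the extensional functions.
\<close>

definition normalised_integral :: "('i, 'k::field) hopf \<Rightarrow> ('i \<Rightarrow> 'k) \<Rightarrow> bool" where
  "normalised_integral H x \<longleftrightarrow> x \<in> extensional (basis H) \<and>
     (\<forall>i\<in>basis H. \<forall>k\<in>basis H. (\<Sum>j\<in>basis H. x j * mulc H i j k) = counitc H i * x k) \<and>
     (\<forall>i\<in>basis H. \<forall>k\<in>basis H. (\<Sum>j\<in>basis H. x j * mulc H j i k) = counitc H i * x k) \<and>
     (\<Sum>j\<in>basis H. x j * counitc H j) = of_nat (card (basis H))"

definition ell :: "('i, 'k::field) hopf \<Rightarrow> 'i \<Rightarrow> 'k" where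
  "ell H = (THE x. normalised_integral H x)"

definition lam :: "('i, 'k::field) hopf \<Rightarrow> 'i \<Rightarrow> 'k" where
  "lam H = ell (dual H)"


section \<open>Basic invariants\<close>

text \<open>
  An element of the tensor product of \<open>r\<close> copies of \<open>H\<^sup>*\<close> and \<open>s\<close> copies of \<open>H\<close> is represented
  by its coefficients: \<open>T xs ys\<close>, for lists \<open>xs\<close> and \<open>ys\<close> of basis indices of length \<open>r\<close> and
  \<open>s\<close>, is the coefficient at the tensor product of the dual basis vectors with indices \<open>xs\<close> and
  the basis vectors with indices \<open>ys\<close>. Other argument lists carry no meaning. Comultiplying the
  factor \<open>j\<close> yields the two adjacent factors \<open>j\<close> and \<open>j + 1\<close>; evaluation pairs factor \<open>i\<close> of
  \<open>H\<^sup>*\<close> with factor \<open>j\<close> of \<open>H\<close> and removes both.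
\<close>

type_synonym ('i, 'k) tensor = "'i list \<Rightarrow> 'i list \<Rightarrow> 'k"

inductive basic_tensor :: "('i, 'k::field) hopf \<Rightarrow> nat \<Rightarrow> nat \<Rightarrow> ('i, 'k) tensor \<Rightarrow> bool"
  for H :: "('i, 'k) hopf" where
  integrals:
    "basic_tensor H r s (\<lambda>xs ys. (\<Prod>i<r. lam H (xs ! i)) * (\<Prod>j<s. ell H (ys ! j)))"
| comult_H:
    "\<lbrakk>basic_tensor H r s T; j < s\<rbrakk> \<Longrightarrow>
     basic_tensor H r (Suc s) (\<lambda>xs ys. \<Sum>k\<in>basis H.
       T xs (take j ys @ k # drop (j + 2) ys) * comulc H k (ys ! j) (ys ! Suc j))"
| comult_dual:
    "\<lbrakk>basic_tensor H r s T; i < r\<rbrakk> \<Longrightarrow>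
     basic_tensor H (Suc r) s (\<lambda>xs ys. \<Sum>k\<in>basis H.
       T (take i xs @ k # drop (i + 2) xs) ys * comulc (dual H) k (xs ! i) (xs ! Suc i))"
| permute_H:
    "\<lbrakk>basic_tensor H r s T; \<sigma> permutes {..<s}\<rbrakk> \<Longrightarrow>
     basic_tensor H r s (\<lambda>xs ys. T xs (permute_list \<sigma> ys))"
| permute_dual:
    "\<lbrakk>basic_tensor H r s T; \<sigma> permutes {..<r}\<rbrakk> \<Longrightarrow>
     basic_tensor H r s (\<lambda>xs ys. T (permute_list \<sigma> xs) ys)"
| evaluate:
    "\<lbrakk>basic_tensor H (Suc r) (Suc s) T; i \<le> r; j \<le> s\<rbrakk> \<Longrightarrow>
     basic_tensor H r s (\<lambda>xs ys. \<Sum>k\<in>basis H.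
       T (take i xs @ k # drop i xs) (take j ys @ k # drop j ys))"

text \<open>Intended for semisimple \<open>H\<close> over a field of characteristic 0, where \<open>ell\<close> and \<open>lam\<close> exist.\<close>

definition basic_invariant :: "('i, 'k::field) hopf \<Rightarrow> 'k \<Rightarrow> bool" where
  "basic_invariant H c \<longleftrightarrow> (\<exists>T. basic_tensor H 0 0 T \<and> c = T [] [])"


section \<open>Group algebras\<close>

definition group_algebra :: "('g, 'm) monoid_scheme \<Rightarrow> ('g, 'k::field) hopf" where
  "group_algebra G = \<lparr>basis = carrier G,
     mulc = (\<lambda>g h k. of_bool (k = g \<otimes>\<^bsub>G\<^esub> h)), unitc = (\<lambda>g. of_bool (g = \<one>\<^bsub>G\<^esub>)),
     comulc = (\<lambda>k g h. of_bool (g = k \<and> h = k)), counitc = (\<lambda>g. 1),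
     antipc = (\<lambda>g h. of_bool (h = inv\<^bsub>G\<^esub> g))\<rparr>"

lemma sum_of_bool_delta:
  fixes f :: "'a \<Rightarrow> 'k::semiring_1"
  assumes "finite A" "a \<in> A"
  shows "(\<Sum>l\<in>A. of_bool (l = a) * f l) = f a" "(\<Sum>l\<in>A. f l * of_bool (l = a)) = f a"
    "(\<Sum>l\<in>A. of_bool (a = l) * f l) = f a" "(\<Sum>l\<in>A. f l * of_bool (a = l)) = f a"
  using assms by (simp_all add: of_bool_def if_distrib if_distribR cong: if_cong)

lemma hopf_algebra_group_algebra:
  fixes G (structure)
  assumes "group G" and fin: "finite (carrier G)"
  shows "hopf_algebra (group_algebra G :: ('g, 'k::field) hopf)"
proof -
  interpret group G by fact
  show ?thesis
    apply unfold_locales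
                 apply (simp_all add: group_algebra_def dual_def fin sum_of_bool_delta m_assoc
                   of_bool_conj mult.assoc flip: sum_distrib_left)
    subgoal for i j k t by (cases "j = t") auto
    subgoal for i j a b
    proof -
      have "{j} \<inter> {r. a = i \<otimes> r} = (if a = i \<otimes> j then {j} else {})"
        and "{j} \<inter> {s. b = i \<otimes> s} = (if b = i \<otimes> j then {j} else {})" by auto
      then show ?thesis by auto
    qed
    done
qed

lemma normalised_integral_group_algebra:
  fixes G (structure)
  assumes "group G" and fin: "finite (carrier G)"
  shows "normalised_integral (group_algebra G) x \<longleftrightarrow>
    x = (\<lambda>g\<in>carrier G. 1 :: 'k::field_char_0)"
proof
  interpret group G by fact
  show "normalised_integral (group_algebra G) x" if "x = (\<lambda>g\<in>carrier G. 1 :: 'k::field_char_0)"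
  proof -
    have "(\<Sum>j\<in>carrier G. of_bool (k = i \<otimes> j)) = (1 :: 'k)"
      "(\<Sum>j\<in>carrier G. of_bool (k = j \<otimes> i)) = (1 :: 'k)"
      if "i \<in> carrier G" "k \<in> carrier G" for i k
    proof -
      have "k = i \<otimes> j \<longleftrightarrow> j = inv i \<otimes> k" "k = j \<otimes> i \<longleftrightarrow> j = k \<otimes> inv i"
        if "j \<in> carrier G" for j
        using that \<open>i \<in> _\<close> \<open>k \<in> _\<close> by (metis inv_solve_left, metis inv_solve_right)
      then have "(\<Sum>j\<in>carrier G. of_bool (k = i \<otimes> j)) =
          (\<Sum>j\<in>carrier G. of_bool (j = inv i \<otimes> k) * (1::'k))"
        "(\<Sum>j\<in>carrier G. of_bool (k = j \<otimes> i)) =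
          (\<Sum>j\<in>carrier G. of_bool (j = k \<otimes> inv i) * (1::'k))"
        by (simp_all cong: sum.cong)
      then show "(\<Sum>j\<in>carrier G. of_bool (k = i \<otimes> j)) = (1 :: 'k)"
        "(\<Sum>j\<in>carrier G. of_bool (k = j \<otimes> i)) = (1 :: 'k)"
        using that fin by (simp_all only: sum_of_bool_delta m_closed inv_closed)
    qed
    then show ?thesis
      using fin that by (simp add: normalised_integral_def group_algebra_def del: sum_of_bool_eq)
  qed
  show "x = (\<lambda>g\<in>carrier G. 1)" if "normalised_integral (group_algebra G) x"
  proof -
    have ext: "x \<in> extensional (carrier G)"
      and int: "\<And>i k. \<lbrakk>i \<in> carrier G; k \<in> carrier G\<rbrakk> \<Longrightarrow>
        (\<Sum>j\<in>carrier G. x j * of_bool (k = i \<otimes> j)) = x k"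
      and norm: "(\<Sum>j\<in>carrier G. x j) = of_nat (card (carrier G))"
      using that by (simp_all add: normalised_integral_def group_algebra_def)
    have const: "x k = x \<one>" if "k \<in> carrier G" for k
    proof -
      have "(\<Sum>j\<in>carrier G. x j * of_bool (k = k \<otimes> j)) =
        (\<Sum>j\<in>carrier G. x j * of_bool (j = \<one>))"
        using that by (intro sum.cong refl) simp
      with int[OF that that] fin show ?thesis by (simp only: sum_of_bool_delta one_closed)
    qed
    have "(\<Sum>j\<in>carrier G. x j) = (\<Sum>j\<in>carrier G. x \<one>)"
      by (rule sum.cong[OF refl const])
    moreover have "card (carrier G) \<noteq> 0" using fin by auto
    ultimately have "x \<one> = 1" using norm by simp
    then have "x k = 1" if "k \<in> carrier G" for k using const[OF that] by simp
    then show ?thesis using ext by (intro extensionalityI[where A = "carrier G"]) auto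
  qed
qed

lemma normalised_integral_dual_group_algebra:
  fixes G (structure)
  assumes "group G" and fin: "finite (carrier G)"
  shows "normalised_integral (dual (group_algebra G)) x \<longleftrightarrow>
    x = (\<lambda>g\<in>carrier G. if g = \<one> then of_nat (order G) else 0 :: 'k::field)"
proof
  interpret group G by fact
  show "normalised_integral (dual (group_algebra G)) x"
    if "x = (\<lambda>g\<in>carrier G. if g = \<one> then of_nat (order G) else 0)"
    using that fin
    by (auto simp: normalised_integral_def group_algebra_def dual_def of_bool_conj
        sum_of_bool_delta order_def intro!: sum.neutral)
  show "x = (\<lambda>g\<in>carrier G. if g = \<one> then of_nat (order G) else 0)"
    if "normalised_integral (dual (group_algebra G)) x"
  proof -
    have ext: "x \<in> extensional (carrier G)"
      and int: "\<And>i k. \<lbrakk>i \<in> carrier G; k \<in> carrier G\<rbrakk> \<Longrightarrow>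
        (\<Sum>j\<in>carrier G. x j * of_bool (i = k \<and> j = k)) = of_bool (i = \<one>) * x k"
      and norm: "(\<Sum>j\<in>carrier G. x j * of_bool (j = \<one>)) = of_nat (card (carrier G))"
      using that by (simp_all add: normalised_integral_def group_algebra_def dual_def)
    have "x \<one> = of_nat (order G)"
      using norm fin by (simp only: sum_of_bool_delta one_closed order_def)
    moreover have "x k = 0" if "k \<in> carrier G" "k \<noteq> \<one>" for k
    proof -
      have "(\<Sum>j\<in>carrier G. x j * of_bool (j = k)) = 0" using int[OF that(1) that(1)] that(2) by simp
      then show ?thesis using that(1) fin by (simp only: sum_of_bool_delta)
    qed
    ultimately show ?thesis using ext by (intro extensionalityI[where A = "carrier G"]) auto
  qed
qed

lemma ell_group_algebra:
  fixes G (structure)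
  assumes "group G" "finite (carrier G)"
  shows "ell (group_algebra G) = (\<lambda>g\<in>carrier G. 1 :: 'k::field_char_0)"
  using normalised_integral_group_algebra[OF assms, where 'k = 'k] by (simp add: ell_def)

lemma lam_group_algebra:
  fixes G (structure)
  assumes "group G" "finite (carrier G)"
  shows "lam (group_algebra G) =
    (\<lambda>g\<in>carrier G. if g = \<one> then of_nat (order G) else 0 :: 'k::field)"
  using normalised_integral_dual_group_algebra[OF assms, where 'k = 'k]
  by (simp add: lam_def ell_def)


section \<open>Finitely presented groups\<close>

text \<open>
  \<open>(x, True)\<close> stands for the generator \<open>x\<close> and \<open>(x, False)\<close> for its inverse. The free group on
  \<open>X\<close> consists of the classes of words modulo insertion and deletion of cancelling pairs.
\<close>

type_synonym 'x word = "('x \<times> bool) list"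

definition words :: "'x set \<Rightarrow> 'x word set" where
  "words X = lists (X \<times> UNIV)"

inductive_set free_eq :: "'x set \<Rightarrow> ('x word \<times> 'x word) set" for X where
  refl: "w \<in> words X \<Longrightarrow> (w, w) \<in> free_eq X"
| cancel: "\<lbrakk>u \<in> words X; v \<in> words X; x \<in> X\<rbrakk> \<Longrightarrow>
    (u @ [(x, b), (x, \<not> b)] @ v, u @ v) \<in> free_eq X"
| sym: "(u, v) \<in> free_eq X \<Longrightarrow> (v, u) \<in> free_eq X"
| trans: "\<lbrakk>(u, v) \<in> free_eq X; (v, w) \<in> free_eq X\<rbrakk> \<Longrightarrow> (u, w) \<in> free_eq X"

definition free_group :: "'x set \<Rightarrow> 'x word set monoid" where
  "free_group X = \<lparr>carrier = words X // free_eq X,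
     mult = (\<lambda>A B. \<Union>u\<in>A. \<Union>v\<in>B. free_eq X `` {u @ v}),
     one = free_eq X `` {[]}\<rparr>"

definition normal_closure :: "('a, 'b) monoid_scheme \<Rightarrow> 'a set \<Rightarrow> 'a set" where
  "normal_closure G R = \<Inter>{N. N \<lhd> G \<and> R \<subseteq> N}"

definition presented_group :: "'x set \<Rightarrow> 'x word set set \<Rightarrow> 'x word set set monoid" where
  "presented_group X R = free_group X Mod normal_closure (free_group X) R"

text \<open>A finite set of generators may be taken to be a set of natural numbers.\<close>

definition finitely_presented :: "('a, 'b) monoid_scheme \<Rightarrow> bool" where
  "finitely_presented P \<longleftrightarrow> group P \<and>
     (\<exists>(X :: nat set) R. finite X \<and> finite R \<and> R \<subseteq> carrier (free_group X) \<and>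
        P \<cong> presented_group X R)"

text \<open>
  The functions in \<open>hom P G\<close> are unconstrained outside \<open>carrier P\<close>; for counting, each
  homomorphism is represented by its extensional version.
\<close>

definition homs :: "('a, 'b) monoid_scheme \<Rightarrow> ('c, 'd) monoid_scheme \<Rightarrow> ('a \<Rightarrow> 'c) set" where
  "homs P G = hom P G \<inter> extensional (carrier P)"

lemma words_simps [simp]:
  "[] \<in> words X" "u @ v \<in> words X \<longleftrightarrow> u \<in> words X \<and> v \<in> words X"
  "p # u \<in> words X \<longleftrightarrow> fst p \<in> X \<and> u \<in> words X"
  by (auto simp: words_def mem_Times_iff)

lemma free_eq_in_words: "(u, v) \<in> free_eq X \<Longrightarrow> u \<in> words X \<and> v \<in> words X"
  by (induction rule: free_eq.induct) auto

lemma equiv_free_eq: "equiv (words X) (free_eq X)"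
proof (rule equivI)
  show "free_eq X \<subseteq> words X \<times> words X" by (auto dest: free_eq_in_words)
  show "refl_on (words X) (free_eq X)" by (rule refl_onI) (rule free_eq.refl)
  show "sym (free_eq X)" by (rule symI) (rule free_eq.sym)
  show "trans (free_eq X)" by (rule transI) (rule free_eq.trans)
qed

lemma free_eq_append_left: "(u, v) \<in> free_eq X \<Longrightarrow> w \<in> words X \<Longrightarrow> (w @ u, w @ v) \<in> free_eq X"
proof (induction rule: free_eq.induct)
  case (cancel u v x b)
  then show ?case using free_eq.cancel[of "w @ u" X v x b] by simp
qed (auto intro: free_eq.refl free_eq.sym free_eq.trans)

lemma free_eq_append_right: "(u, v) \<in> free_eq X \<Longrightarrow> w \<in> words X \<Longrightarrow> (u @ w, v @ w) \<in> free_eq X"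
proof (induction rule: free_eq.induct)
  case (cancel u v x b)
  then show ?case using free_eq.cancel[of u X "v @ w" x b] by simp
qed (auto intro: free_eq.refl free_eq.sym free_eq.trans)

lemma free_eq_append:
  "\<lbrakk>(u, u') \<in> free_eq X; (v, v') \<in> free_eq X\<rbrakk> \<Longrightarrow> (u @ v, u' @ v') \<in> free_eq X"
  by (meson free_eq.trans free_eq_append_left free_eq_append_right free_eq_in_words)

lemma free_group_mult:
  assumes "u \<in> words X" "v \<in> words X"
  shows "free_eq X `` {u} \<otimes>\<^bsub>free_group X\<^esub> free_eq X `` {v} = free_eq X `` {u @ v}"
proof -
  have "congruent2 (free_eq X) (free_eq X) (\<lambda>u v. free_eq X `` {u @ v})"
    by (rule congruent2I')
      (meson equiv_class_eq equiv_free_eq free_eq_append)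
  from UN_equiv_class2[OF equiv_free_eq equiv_free_eq this assms]
  show ?thesis by (simp add: free_group_def)
qed

lemma free_group_carrierE:
  assumes "A \<in> carrier (free_group X)"
  obtains u where "u \<in> words X" "A = free_eq X `` {u}"
  using assms by (auto simp: free_group_def elim: quotientE)

lemma free_group_carrierI [intro]: "u \<in> words X \<Longrightarrow> free_eq X `` {u} \<in> carrier (free_group X)"
  by (auto simp: free_group_def intro: quotientI)

lemma free_eq_inverse:
  "u \<in> words X \<Longrightarrow> (rev (map (\<lambda>(x, b). (x, \<not> b)) u) @ u, []) \<in> free_eq X"
proof (induction u)
  case Nil
  then show ?case by (simp add: free_eq.refl)
next
  case (Cons p u)
  obtain x b where p: "p = (x, b)" by (cases p)
  let ?r = "rev (map (\<lambda>(x, b). (x, \<not> b)) u)"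
  have "?r \<in> words X" using Cons.prems by (auto simp: words_def)
  then have "(?r @ [(x, \<not> b), (x, \<not> \<not> b)] @ u, ?r @ u) \<in> free_eq X"
    using Cons.prems p by (intro free_eq.cancel) auto
  then show ?case using Cons p by (auto intro: free_eq.trans)
qed

lemma group_free_group: "group (free_group X)"
proof (rule groupI)
  show one: "\<one>\<^bsub>free_group X\<^esub> \<in> carrier (free_group X)"
    using free_group_carrierI[of "[]" X] by (simp add: free_group_def)
  show "A \<otimes>\<^bsub>free_group X\<^esub> B \<in> carrier (free_group X)"
    if "A \<in> carrier (free_group X)" "B \<in> carrier (free_group X)" for A B
    using that by (elim free_group_carrierE) (auto simp: free_group_mult)
  show "A \<otimes>\<^bsub>free_group X\<^esub> B \<otimes>\<^bsub>free_group X\<^esub> C = A \<otimes>\<^bsub>free_group X\<^esub> (B \<otimes>\<^bsub>free_group X\<^esub> C)"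
    if "A \<in> carrier (free_group X)" "B \<in> carrier (free_group X)" "C \<in> carrier (free_group X)"
    for A B C
    using that by (elim free_group_carrierE) (simp add: free_group_mult)
  have one_eq: "\<one>\<^bsub>free_group X\<^esub> = free_eq X `` {[]}" by (simp add: free_group_def)
  show "\<one>\<^bsub>free_group X\<^esub> \<otimes>\<^bsub>free_group X\<^esub> A = A" if "A \<in> carrier (free_group X)" for A
    using that unfolding one_eq by (elim free_group_carrierE) (simp add: free_group_mult)
  show "\<exists>B\<in>carrier (free_group X). B \<otimes>\<^bsub>free_group X\<^esub> A = \<one>\<^bsub>free_group X\<^esub>"
    if "A \<in> carrier (free_group X)" for A
  proof -
    obtain u where u: "u \<in> words X" "A = free_eq X `` {u}"
      using \<open>A \<in> carrier (free_group X)\<close> by (rule free_group_carrierE)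
    let ?r = "rev (map (\<lambda>(x, b). (x, \<not> b)) u)"
    have r: "?r \<in> words X" using u(1) by (auto simp: words_def)
    have "free_eq X `` {?r @ u} = free_eq X `` {[]}"
      using free_eq_inverse[OF u(1)] equiv_free_eq by (metis equiv_class_eq)
    then have "free_eq X `` {?r} \<otimes>\<^bsub>free_group X\<^esub> A = \<one>\<^bsub>free_group X\<^esub>"
      using u r by (simp add: free_group_mult one_eq)
    then show ?thesis using r by blast
  qed
qed

lemma (in group) normal_closure_normal:
  assumes "R \<subseteq> carrier G"
  shows "normal_closure G R \<lhd> G"
proof -
  have "carrier G \<lhd> G" by (simp add: normal_inv_iff subgroup_self)
  with assms have "{N. N \<lhd> G \<and> R \<subseteq> N} \<noteq> {}" by blast
  then have "subgroup (normal_closure G R) G"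
    unfolding normal_closure_def by (intro subgroups_Inter) (auto intro: normal_imp_subgroup)
  then show ?thesis
    by (auto simp: normal_inv_iff normal_closure_def)
qed

lemma group_presented_group:
  "R \<subseteq> carrier (free_group X) \<Longrightarrow> group (presented_group X R)"
  unfolding presented_group_def
  by (intro normal.factorgroup_is_group group.normal_closure_normal group_free_group)

lemma finitely_presented_presented_group:
  "\<lbrakk>finite X; finite R; R \<subseteq> carrier (free_group X)\<rbrakk> \<Longrightarrow>
    finitely_presented (presented_group (X :: nat set) R)"
  unfolding finitely_presented_def
  by (intro conjI exI[of _ X] exI[of _ R] group_presented_group iso_refl)

end

theory Submission
  imports Defs
begin

text \<open>
  In a group algebra the integrals and the comultiplications are as sparse as they can be. The
  integral of \<open>H\<close> is the sum of all group elements, so it stands for an unconstrained group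
  element. The integral of the dual is \<open>n\<close> times the delta function at the identity, so it stands
  for the equation \<open>x = 1\<close> together with a factor \<open>n\<close>. Comultiplication in \<open>H\<close> duplicates a group
  element, comultiplication in the dual splits a group element into two factors, and evaluation
  equates two group elements. Hence a basic invariant counts the solutions in \<open>G\<close> of a finite
  system of equations between words, up to a power of \<open>n\<close>, and a solution of such a system is a
  homomorphism from the group which the system presents.

  To make this an induction along the construction of the invariant, the claim is extended to
  all basic tensors: up to a power of \<open>n\<close>, the coefficient at given group elements is the number
  of those solutions of a word system that take these group elements as values at a
  prescribed list of variables (\<open>solution_counting\<close>, \<open>basic_tensor_solution_counting\<close>). Each
  operation changes only the system and the list of variables: evaluation adds the relator \<open>u v\<inverse>\<close>,
  and comultiplication in the dual adds two variables \<open>p\<close>, \<open>q\<close> and the relator \<open>p q u\<inverse>\<close>. A scalar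
  is a tensor without coefficients to prescribe, so it counts all solutions; the universal
  property of presentations (\<open>card_homs_presented_group\<close>) turns this into a count of homomorphisms.
\<close>


section \<open>Words and their solutions in a group\<close>

primrec word_value :: "('g, 'm) monoid_scheme \<Rightarrow> ('x \<Rightarrow> 'g) \<Rightarrow> 'x word \<Rightarrow> 'g" where
  "word_value G \<phi> [] = \<one>\<^bsub>G\<^esub>"
| "word_value G \<phi> (p # w) =
    (if snd p then \<phi> (fst p) else inv\<^bsub>G\<^esub> \<phi> (fst p)) \<otimes>\<^bsub>G\<^esub> word_value G \<phi> w"

definition solutions :: "('g, 'm) monoid_scheme \<Rightarrow> 'x set \<Rightarrow> 'x word set \<Rightarrow> ('x \<Rightarrow> 'g) set" where
  "solutions G X R = {\<phi> \<in> X \<rightarrow>\<^sub>E carrier G. \<forall>w\<in>R. word_value G \<phi> w = \<one>\<^bsub>G\<^esub>}"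

lemma finite_solutions: "\<lbrakk>finite X; finite (carrier G)\<rbrakk> \<Longrightarrow> finite (solutions G X R)"
  by (simp add: solutions_def finite_PiE)

lemma word_value_cong:
  "\<lbrakk>w \<in> words X; \<And>x. x \<in> X \<Longrightarrow> \<phi> x = \<psi> x\<rbrakk> \<Longrightarrow> word_value G \<phi> w = word_value G \<psi> w"
  by (induction w) auto

context group
begin

lemma word_value_closed [simp]:
  "\<lbrakk>\<phi> \<in> X \<rightarrow> carrier G; w \<in> words X\<rbrakk> \<Longrightarrow> word_value G \<phi> w \<in> carrier G"
  by (induction w) (auto simp: Pi_iff)

lemma word_value_append:
  "\<lbrakk>\<phi> \<in> X \<rightarrow> carrier G; u \<in> words X; v \<in> words X\<rbrakk> \<Longrightarrow>
    word_value G \<phi> (u @ v) = word_value G \<phi> u \<otimes> word_value G \<phi> v"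
proof (induction u)
  case (Cons p u)
  then have "\<phi> (fst p) \<in> carrier G" by auto
  with Cons show ?case by (auto simp: m_assoc)
qed simp

lemma word_value_free_eq:
  assumes "(u, v) \<in> free_eq X" and \<phi>: "\<phi> \<in> X \<rightarrow> carrier G"
  shows "word_value G \<phi> u = word_value G \<phi> v"
  using assms(1)
proof (induction rule: free_eq.induct)
  case (cancel u v x b)
  have x: "\<phi> x \<in> carrier G" using cancel \<phi> by auto
  have "word_value G \<phi> ([(x, b), (x, \<not> b)] @ v) = word_value G \<phi> v"
    using x word_value_closed[OF \<phi> cancel(2)] by (cases b) (simp_all flip: m_assoc)
  then show ?case using cancel \<phi> by (simp add: word_value_append[OF \<phi>])
qed auto

text \<open>
  Evaluation of words respects \<open>free_eq\<close>, so it induces a map on classes; this is the universal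
  property of the free group.
\<close>

lemma word_value_hom_free_group:
  assumes \<phi>: "\<phi> \<in> X \<rightarrow> carrier G"
  obtains f where "f \<in> hom (free_group X) G"
    and "\<And>w. w \<in> words X \<Longrightarrow> f (free_eq X `` {w}) = word_value G \<phi> w"
proof
  let ?f = "\<lambda>A. word_value G \<phi> (SOME w. w \<in> A)"
  show f: "?f (free_eq X `` {w}) = word_value G \<phi> w" if "w \<in> words X" for w
  proof -
    have "(SOME v. v \<in> free_eq X `` {w}) \<in> free_eq X `` {w}"
      using free_eq.refl[OF that] unfolding some_in_eq by auto
    then have "(w, SOME v. v \<in> free_eq X `` {w}) \<in> free_eq X" by (simp only: Image_singleton_iff)
    from word_value_free_eq[OF this \<phi>] show ?thesis by (rule HOL.sym)
  qed
  show "?f \<in> hom (free_group X) G"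
  proof (rule homI)
    fix A B assume "A \<in> carrier (free_group X)" "B \<in> carrier (free_group X)"
    then obtain u v where uv: "u \<in> words X" "v \<in> words X"
      and AB: "A = free_eq X `` {u}" "B = free_eq X `` {v}"
      by (elim free_group_carrierE)
    have "?f (free_eq X `` {u @ v}) = ?f (free_eq X `` {u}) \<otimes> ?f (free_eq X `` {v})"
      unfolding f[OF uv(1)] f[OF uv(2)] using f[of "u @ v"] uv word_value_append[OF \<phi> uv] by simp
    then show "?f (A \<otimes>\<^bsub>free_group X\<^esub> B) = ?f A \<otimes> ?f B"
      unfolding AB free_group_mult[OF uv] .
  next
    fix A assume "A \<in> carrier (free_group X)"
    then obtain u where u: "u \<in> words X" and A: "A = free_eq X `` {u}"
      by (rule free_group_carrierE)
    show "?f A \<in> carrier G" unfolding A f[OF u] using \<phi> u by (rule word_value_closed)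
  qed
qed

end


section \<open>The universal property of a presentation\<close>

definition relators :: "'x set \<Rightarrow> 'x word set \<Rightarrow> 'x word set set" where
  "relators X R = (\<lambda>w. free_eq X `` {w}) ` R"

definition presented_class :: "'x set \<Rightarrow> 'x word set \<Rightarrow> 'x word \<Rightarrow> 'x word set set" where
  "presented_class X R w =
    normal_closure (free_group X) (relators X R) #>\<^bsub>free_group X\<^esub> (free_eq X `` {w})"

context
  fixes X :: "'x set" and R :: "'x word set"
  assumes R: "R \<subseteq> words X"
begin

lemma relators_subset: "relators X R \<subseteq> carrier (free_group X)"
  using R by (auto simp: relators_def)

lemma normal_closure_relators: "normal_closure (free_group X) (relators X R) \<lhd> free_group X"
  by (rule group.normal_closure_normal[OF group_free_group relators_subset])

lemma carrier_presented_group: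
  "carrier (presented_group X (relators X R)) = presented_class X R ` words X"
proof -
  have "carrier (free_group X) = (\<lambda>w. free_eq X `` {w}) ` words X"
    by (auto elim: free_group_carrierE)
  then show ?thesis
    unfolding presented_group_def FactGroup_def RCOSETS_def presented_class_def by auto
qed

lemma presented_class_mult:
  "\<lbrakk>u \<in> words X; v \<in> words X\<rbrakk> \<Longrightarrow>
    presented_class X R u \<otimes>\<^bsub>presented_group X (relators X R)\<^esub> presented_class X R v =
    presented_class X R (u @ v)"
  by (simp add: presented_class_def presented_group_def FactGroup_def free_group_mult
      normal.rcos_sum[OF normal_closure_relators] free_group_carrierI)

lemma presented_class_relator:
  assumes "w \<in> R"
  shows "presented_class X R w = presented_class X R []"
proof -
  interpret F: group "free_group X" by (rule group_free_group)
  interpret N: normal "normal_closure (free_group X) (relators X R)" "free_group X"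
    by (rule normal_closure_relators)
  have "free_eq X `` {w} \<in> normal_closure (free_group X) (relators X R)"
    using assms by (auto simp: normal_closure_def relators_def)
  moreover have "\<one>\<^bsub>free_group X\<^esub> = free_eq X `` {[]}" by (simp add: free_group_def)
  ultimately show ?thesis
    unfolding presented_class_def
    by (metis F.coset_join2 F.one_closed N.is_subgroup N.one_closed N.subset subsetD)
qed

text \<open>
  Existence half of the universal property: the kernel of the evaluation map on the free group is
  a normal subgroup containing the relators, so it contains their normal closure.
\<close>

lemma solution_extends_to_hom:
  assumes "group G" and \<phi>: "\<phi> \<in> solutions G X R"
  obtains h where "h \<in> hom (presented_group X (relators X R)) G"
    and "\<And>w. w \<in> words X \<Longrightarrow> h (presented_class X R w) = word_value G \<phi> w"
proof -
  interpret G: group G by fact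
  interpret F: group "free_group X" by (rule group_free_group)
  let ?N = "normal_closure (free_group X) (relators X R)"
  have \<phi>': "\<phi> \<in> X \<rightarrow> carrier G" using \<phi> by (auto simp: solutions_def)
  obtain f where hom: "f \<in> hom (free_group X) G"
    and f: "\<And>w. w \<in> words X \<Longrightarrow> f (free_eq X `` {w}) = word_value G \<phi> w"
    using G.word_value_hom_free_group[OF \<phi>'] by blast
  interpret f: group_hom "free_group X" G f
    by unfold_locales (rule hom)
  have "relators X R \<subseteq> kernel (free_group X) G f"
    using R \<phi> by (auto simp: relators_def kernel_def f solutions_def)
  then have "?N \<subseteq> kernel (free_group X) G f"
    unfolding normal_closure_def using f.normal_kernel by blast
  then obtain h where "h \<in> hom (free_group X Mod ?N) G"
    and h: "\<And>A. A \<in> carrier (free_group X) \<Longrightarrow> h (?N #>\<^bsub>free_group X\<^esub> A) = f A"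
    using f.FactGroup_universal_kernel[OF normal_closure_relators] by blast
  show thesis
  proof (rule that)
    show "h \<in> hom (presented_group X (relators X R)) G"
      unfolding presented_group_def by fact
    show "h (presented_class X R w) = word_value G \<phi> w" if "w \<in> words X" for w
      using that by (simp add: presented_class_def h f free_group_carrierI)
  qed
qed

text \<open>
  Uniqueness half of the universal property: a homomorphism is determined by its values at the
  generators.
\<close>

lemma hom_presented_class:
  assumes "group G" and h: "h \<in> hom (presented_group X (relators X R)) G"
  shows "w \<in> words X \<Longrightarrow> h (presented_class X R w) =
    word_value G (\<lambda>x\<in>X. h (presented_class X R [(x, True)])) w"
proof -
  interpret P: group "presented_group X (relators X R)"
    by (rule group_presented_group[OF relators_subset])
  interpret h: group_hom "presented_group X (relators X R)" G h
    using assms by (simp add: group_hom_def group_hom_axioms_def P.is_group)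
  have closed: "presented_class X R w \<in> carrier (presented_group X (relators X R))"
    if "w \<in> words X" for w using that by (simp add: carrier_presented_group)
  have one: "presented_class X R [] = \<one>\<^bsub>presented_group X (relators X R)\<^esub>"
    using presented_class_mult[of "[]" "[]"] closed[of "[]"] by simp
  have inv: "presented_class X R [(x, False)] =
      inv\<^bsub>presented_group X (relators X R)\<^esub> presented_class X R [(x, True)]" if "x \<in> X" for x
  proof -
    have "([(x, False), (x, True)], []) \<in> free_eq X"
      using free_eq.cancel[of "[]" X "[]" x False] that by simp
    then have "presented_class X R ([(x, False)] @ [(x, True)]) = presented_class X R []"
      unfolding presented_class_def using equiv_class_eq[OF equiv_free_eq] by fastforce
    then show ?thesis
      using that one presented_class_mult[of "[(x, False)]" "[(x, True)]"]
      by (intro P.inv_equality[symmetric]) (auto intro!: closed)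
  qed
  show "w \<in> words X \<Longrightarrow> ?thesis"
  proof (induction w)
    case Nil
    then show ?case by (simp add: one)
  next
    case (Cons p w)
    obtain x b where p: "p = (x, b)" by (cases p)
    have "h (presented_class X R (p # w)) =
        h (presented_class X R [p] \<otimes>\<^bsub>presented_group X (relators X R)\<^esub> presented_class X R w)"
      using Cons.prems by (simp add: presented_class_mult)
    also have "\<dots> = h (presented_class X R [p]) \<otimes>\<^bsub>G\<^esub> h (presented_class X R w)"
      using Cons.prems by (intro h.hom_mult closed) auto
    finally show ?case
      using Cons p inv[of x] closed[of "[(x, True)]"] by auto
  qed
qed

text \<open>Restricting a homomorphism to the generators is a bijection onto the solutions.\<close>

theorem card_homs_presented_group:
  assumes "group G"
  shows "card (homs (presented_group X (relators X R)) G) = card (solutions G X R)"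
proof -
  interpret G: group G by fact
  let ?P = "presented_group X (relators X R)"
  interpret P: group ?P by (rule group_presented_group[OF relators_subset])
  let ?F = "\<lambda>h. \<lambda>x\<in>X. h (presented_class X R [(x, True)])"
  have closed: "presented_class X R w \<in> carrier ?P" if "w \<in> words X" for w
    using that by (simp add: carrier_presented_group)
  have "bij_betw ?F (homs ?P G) (solutions G X R)"
    unfolding bij_betw_def
  proof (intro conjI equalityI subsetI)
    show "inj_on ?F (homs ?P G)"
    proof (rule inj_onI)
      fix h k assume h: "h \<in> homs ?P G" and k: "k \<in> homs ?P G" and eq: "?F h = ?F k"
      show "h = k"
      proof (rule extensionalityI[where A = "carrier ?P"])
        fix C assume "C \<in> carrier ?P"
        then obtain w where w: "w \<in> words X" "C = presented_class X R w"
          by (auto simp: carrier_presented_group)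
        show "h C = k C"
          using hom_presented_class[OF \<open>group G\<close> _ w(1), of h]
            hom_presented_class[OF \<open>group G\<close> _ w(1), of k] h k eq w
          by (simp add: homs_def)
      qed (use h k in \<open>auto simp: homs_def\<close>)
    qed
    fix \<phi> assume "\<phi> \<in> ?F ` homs ?P G"
    then obtain h where h: "h \<in> hom ?P G" and \<phi>: "\<phi> = ?F h" by (auto simp: homs_def)
    have "\<phi> \<in> X \<rightarrow>\<^sub>E carrier G" using h closed by (auto simp: \<phi> hom_def Pi_iff)
    moreover have "word_value G \<phi> w = \<one>\<^bsub>G\<^esub>" if "w \<in> R" for w
    proof -
      have "word_value G \<phi> w = h (presented_class X R w)"
        using hom_presented_class[OF \<open>group G\<close> h, of w] that R \<phi> by auto
      also have "\<dots> = h (presented_class X R [])" using presented_class_relator[OF that] by simp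
      also have "\<dots> = \<one>\<^bsub>G\<^esub>" using hom_presented_class[OF \<open>group G\<close> h, of "[]"] by simp
      finally show ?thesis .
    qed
    ultimately show "\<phi> \<in> solutions G X R" by (simp add: solutions_def)
  next
    fix \<phi> assume \<phi>: "\<phi> \<in> solutions G X R"
    then have \<phi>': "\<phi> \<in> X \<rightarrow> carrier G" "\<phi> \<in> extensional X" by (auto simp: solutions_def PiE_def)
    obtain k where k: "k \<in> hom ?P G"
      and kw: "\<And>w. w \<in> words X \<Longrightarrow> k (presented_class X R w) = word_value G \<phi> w"
      using solution_extends_to_hom[OF \<open>group G\<close> \<phi>] by blast
    define h where "h = restrict k (carrier ?P)"
    have h: "h (presented_class X R w) = word_value G \<phi> w" if "w \<in> words X" for w
      using that kw closed by (simp add: h_def)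
    have "h \<in> homs ?P G"
      using k P.subgroup_self by (auto simp: homs_def h_def hom_def P.m_closed)
    moreover have "?F h = \<phi>"
      using \<phi>' by (intro extensionalityI[where A = X]) (auto simp: h Pi_iff)
    ultimately show "\<phi> \<in> ?F ` homs ?P G" by blast
  qed
  then show ?thesis by (rule bij_betw_same_card)
qed

end


section \<open>Basic tensors of a group algebra count solutions\<close>

definition matching_solutions ::
  "('g, 'm) monoid_scheme \<Rightarrow> 'x set \<Rightarrow> 'x word set \<Rightarrow> 'x list \<Rightarrow> 'x list \<Rightarrow> 'g list \<Rightarrow> 'g list \<Rightarrow> ('x \<Rightarrow> 'g) set"
  where "matching_solutions G X R us vs xs ys =
    {\<phi> \<in> solutions G X R. map \<phi> us = xs \<and> map \<phi> vs = ys}"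

text \<open>
  The invariant of the induction. The variable \<open>us ! i\<close> carries the index at the \<open>i\<close>-th factor of
  the dual and \<open>vs ! j\<close> the index at the \<open>j\<close>-th factor of the algebra. The lists need not be
  distinct: repeating a variable is how equality of two indices is expressed. The variables are natural
  numbers so that fresh ones exist at every stage.
\<close>

definition solution_counting ::
  "('g, 'm) monoid_scheme \<Rightarrow> nat \<Rightarrow> nat \<Rightarrow> ('g, 'k::field) tensor \<Rightarrow> bool" where
  "solution_counting G r s T \<longleftrightarrow> (\<exists>a (X :: nat set) R us vs.
     finite X \<and> finite R \<and> R \<subseteq> words X \<and>
     us \<in> lists X \<and> length us = r \<and> vs \<in> lists X \<and> length vs = s \<and>
     (\<forall>xs ys. xs \<in> lists (carrier G) \<and> length xs = r \<and> ys \<in> lists (carrier G) \<and> length ys = s \<longrightarrow>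
        T xs ys = of_nat (order G ^ a * card (matching_solutions G X R us vs xs ys))))"

lemma solution_countingI:
  assumes "finite (X :: nat set)" "finite R" "R \<subseteq> words X"
    and "us \<in> lists X" "length us = r" "vs \<in> lists X" "length vs = s"
    and "\<And>xs ys. \<lbrakk>xs \<in> lists (carrier G); length xs = r; ys \<in> lists (carrier G); length ys = s\<rbrakk> \<Longrightarrow>
        T xs ys = of_nat (order G ^ a * card (matching_solutions G X R us vs xs ys))"
  shows "solution_counting G r s T"
  unfolding solution_counting_def
  by (intro exI[of _ a] exI[of _ X] exI[of _ R] exI[of _ us] exI[of _ vs] conjI allI impI;
      (elim conjE)?; rule assms; assumption?)

lemma solution_countingE:
  assumes "solution_counting G r s T"
  obtains a and X :: "nat set" and R us vs where "finite X" "finite R" "R \<subseteq> words X"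
    "us \<in> lists X" "length us = r" "vs \<in> lists X" "length vs = s"
    "\<And>xs ys. \<lbrakk>xs \<in> lists (carrier G); length xs = r; ys \<in> lists (carrier G); length ys = s\<rbrakk> \<Longrightarrow>
        T xs ys = of_nat (order G ^ a * card (matching_solutions G X R us vs xs ys))"
  using assms(1) unfolding solution_counting_def
  by (elim exE conjE) (rule that; simp)

lemma lists_nth_in: "\<lbrakk>xs \<in> lists A; i < length xs\<rbrakk> \<Longrightarrow> xs ! i \<in> A"
  by (metis in_lists_conv_set nth_mem)

text \<open>
  The next three facts compare the values at a list of variables with an index list in which one
  position is inserted, or two positions are merged or split. They translate the \<open>take\<close>-\<open>drop\<close>
  expressions of evaluation and comultiplication into conditions on single variables.
\<close>

lemma map_eq_insert_iff:
  assumes "i < length us" "length zs = length us - 1"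
  shows "map \<phi> us = take i zs @ k # drop i zs \<longleftrightarrow>
    k = \<phi> (us ! i) \<and> map \<phi> (take i us @ drop (Suc i) us) = zs"
proof -
  have us: "us = take i us @ us ! i # drop (Suc i) us"
    using assms(1) by (rule id_take_nth_drop)
  have "map \<phi> us = take i zs @ k # drop i zs \<longleftrightarrow>
      map \<phi> (take i us) @ \<phi> (us ! i) # map \<phi> (drop (Suc i) us) = take i zs @ k # drop i zs"
    by (subst us) simp
  also have "\<dots> \<longleftrightarrow> map \<phi> (take i us) = take i zs \<and> \<phi> (us ! i) = k \<and>
      map \<phi> (drop (Suc i) us) = drop i zs"
    using assms by (subst append_eq_append_conv) auto
  also have "\<dots> \<longleftrightarrow> k = \<phi> (us ! i) \<and>
      map \<phi> (take i us) @ map \<phi> (drop (Suc i) us) = take i zs @ drop i zs"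
    using assms by (subst append_eq_append_conv) auto
  finally show ?thesis by simp
qed

lemma map_eq_split_iff:
  assumes "i < length us" "length xs = Suc (length us)"
  shows "map \<phi> (take i us @ p # q # drop (Suc i) us) = xs \<longleftrightarrow>
    map \<phi> (take i us) = take i xs \<and> \<phi> p = xs ! i \<and> \<phi> q = xs ! Suc i \<and>
    map \<phi> (drop (Suc i) us) = drop (Suc (Suc i)) xs"
proof -
  have xs: "xs = take i xs @ xs ! i # xs ! Suc i # drop (Suc (Suc i)) xs"
    using assms by (simp add: Cons_nth_drop_Suc)
  show ?thesis
    using assms by (subst xs, subst map_append, subst append_eq_append_conv) auto
qed

lemma map_eq_merge_iff:
  assumes "i < length us" "length xs = Suc (length us)"
  shows "map \<phi> us = take i xs @ k # drop (Suc (Suc i)) xs \<longleftrightarrow>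
    map \<phi> (take i us) = take i xs \<and> \<phi> (us ! i) = k \<and> map \<phi> (drop (Suc i) us) = drop (Suc (Suc i)) xs"
proof -
  have us: "us = take i us @ us ! i # drop (Suc i) us"
    using assms(1) by (rule id_take_nth_drop)
  show ?thesis
    using assms by (subst us, subst map_append, subst append_eq_append_conv) auto
qed

text \<open>
  Contraction over an index \<open>k\<close> that every counted object \<open>\<phi>\<close> determines: the sum only removes
  the prescription of \<open>k\<close>.
\<close>

lemma sum_card_fibres:
  assumes "finite A" "finite S"
    and "\<And>\<phi>. \<phi> \<in> S \<Longrightarrow> f \<phi> \<in> A" "\<And>\<phi> k. \<lbrakk>\<phi> \<in> S; P \<phi> k\<rbrakk> \<Longrightarrow> k = f \<phi>"
  shows "(\<Sum>k\<in>A. card {\<phi> \<in> S. P \<phi> k}) = card {\<phi> \<in> S. P \<phi> (f \<phi>)}"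
proof -
  have "{\<phi> \<in> S. P \<phi> (f \<phi>)} = (\<Union>k\<in>A. {\<phi> \<in> S. P \<phi> k})" using assms(3,4) by blast
  moreover have disjoint: "{\<phi> \<in> S. P \<phi> k} \<inter> {\<phi> \<in> S. P \<phi> l} = {}" if "k \<noteq> l" for k l
    using assms(4)[of _ k] assms(4)[of _ l] that by blast
  moreover have "card (\<Union>k\<in>A. {\<phi> \<in> S. P \<phi> k}) = (\<Sum>k\<in>A. card {\<phi> \<in> S. P \<phi> k})"
    using assms(1,2) disjoint by (intro card_UN_disjoint) auto
  ultimately show ?thesis by simp
qed

context
  fixes G :: "('g, 'm) monoid_scheme" (structure)
  assumes G: "group G" and fin: "finite (carrier G)"
begin

interpretation group G by (rule G)

text \<open>
  There is one variable per factor, and those of the dual factors are relators. The indices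
  prescribe all variables, so the count is one or zero, and each dual factor
  contributes one factor \<open>order G\<close>.
\<close>

lemma solution_counting_integrals:
  "solution_counting G r s
    (\<lambda>xs ys. (\<Prod>i<r. lam (group_algebra G) (xs ! i)) * (\<Prod>j<s. ell (group_algebra G) (ys ! j)) :: 'k::field_char_0)"
proof (rule solution_countingI)
  let ?X = "{..<r + s}" and ?R = "(\<lambda>i. [(i, True)]) ` {..<r}"
  show "finite ?X" "finite ?R" "?R \<subseteq> words ?X" "[0..<r] \<in> lists ?X" "length [0..<r] = r"
    "[r..<r+s] \<in> lists ?X" "length [r..<r+s] = s"
    by auto
  fix xs ys assume xs: "xs \<in> lists (carrier G)" "length xs = r"
    and ys: "ys \<in> lists (carrier G)" "length ys = s"
  let ?M = "matching_solutions G ?X ?R [0..<r] [r..<r+s] xs ys"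
  \<comment> \<open>The only assignment that can match the indices.\<close>
  define \<phi>\<^sub>0 where "\<phi>\<^sub>0 = (\<lambda>i\<in>?X. (xs @ ys) ! i)"
  have xs_in: "xs ! i \<in> carrier G" if "i < r" for i using lists_nth_in[OF xs(1)] xs(2) that by simp
  have ys_in: "ys ! i \<in> carrier G" if "i < s" for i using lists_nth_in[OF ys(1)] ys(2) that by simp
  have unique: "\<phi> = \<phi>\<^sub>0 \<and> (\<forall>i<r. xs ! i = \<one>)" if "\<phi> \<in> ?M" for \<phi>
  proof -
    from that have \<phi>: "\<phi> \<in> ?X \<rightarrow>\<^sub>E carrier G" and rel: "\<And>i. i < r \<Longrightarrow> \<phi> i \<otimes> \<one> = \<one>"
      and m: "map \<phi> [0..<r] = xs" "map \<phi> [r..<r+s] = ys"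
      by (auto simp: matching_solutions_def solutions_def)
    have x: "\<phi> i = xs ! i" if "i < r" for i using m(1) that by auto
    have "map \<phi> [0..<r+s] = xs @ ys" using m by (simp add: upt_add_eq_append[of 0])
    then have "\<phi> i = (xs @ ys) ! i" if "i < r + s" for i
      using that by (metis add_0 length_upt minus_nat.diff_0 nth_map nth_upt)
    then have "\<phi> = \<phi>\<^sub>0"
      using \<phi> by (intro extensionalityI[where A = ?X]) (auto simp: \<phi>\<^sub>0_def PiE_def)
    moreover have "xs ! i = \<one>" if "i < r" for i
      using rel[OF that] x[OF that] xs_in[OF that] by simp
    ultimately show ?thesis by blast
  qed
  have mem: "\<phi>\<^sub>0 \<in> ?M" if "\<forall>i<r. xs ! i = \<one>"
  proof -
    have "\<phi>\<^sub>0 \<in> ?X \<rightarrow>\<^sub>E carrier G" using xs(2) ys(2) xs_in ys_in by (auto simp: \<phi>\<^sub>0_def nth_append)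
    moreover have "map \<phi>\<^sub>0 [0..<r] = xs" "map \<phi>\<^sub>0 [r..<r+s] = ys"
      using xs(2) ys(2) by (auto simp: \<phi>\<^sub>0_def nth_append intro!: nth_equalityI)
    moreover have "\<phi>\<^sub>0 i = \<one>" if "i < r" for i
      using \<open>\<forall>i<r. xs ! i = \<one>\<close> that xs(2) by (simp add: \<phi>\<^sub>0_def nth_append)
    ultimately show ?thesis by (simp add: matching_solutions_def solutions_def)
  qed
  have card: "card ?M = of_bool (\<forall>i<r. xs ! i = \<one>)"
  proof (cases "\<forall>i<r. xs ! i = \<one>")
    case True
    then have "?M = {\<phi>\<^sub>0}" using unique mem by blast
    then show ?thesis using True by simp
  next
    case False
    then have "?M = {}" using unique by blast
    then show ?thesis using False by simp
  qed
  have "(\<Prod>i<r. lam (group_algebra G) (xs ! i)) = (\<Prod>i<r. of_nat (order G) * of_bool (xs ! i = \<one>) :: 'k)"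
    using xs_in by (intro prod.cong) (auto simp: lam_group_algebra[OF G fin])
  also have "\<dots> = of_nat (order G) ^ r * of_bool (\<forall>i<r. xs ! i = \<one>)"
    by (cases "\<forall>i<r. xs ! i = \<one>") (auto simp: prod.distrib)
  moreover have "(\<Prod>j<s. ell (group_algebra G) (ys ! j)) = (1 :: 'k)"
    using ys_in by (intro prod.neutral) (auto simp: ell_group_algebra[OF G fin])
  ultimately show "(\<Prod>i<r. lam (group_algebra G) (xs ! i)) * (\<Prod>j<s. ell (group_algebra G) (ys ! j)) =
      (of_nat (order G ^ r * card ?M) :: 'k)"
    by (simp add: card)
qed

text \<open>
  Group elements are grouplike, so the two new indices agree: the variable of the
  comultiplied factor is listed twice.
\<close>

lemma solution_counting_comult_H:
  assumes "solution_counting G r s T" and j: "j < s"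
  shows "solution_counting G r (Suc s) (\<lambda>xs ys. \<Sum>k\<in>basis (group_algebra G).
       T xs (take j ys @ k # drop (j + 2) ys) * comulc (group_algebra G) k (ys ! j) (ys ! Suc j) :: 'k::field_char_0)"
  using assms(1)
proof (rule solution_countingE)
  fix a and X :: "nat set" and R us vs
  assume fX: "finite X" and R: "finite R" "R \<subseteq> words X"
    and us: "us \<in> lists X" "length us = r" and vs: "vs \<in> lists X" "length vs = s"
    and T: "\<And>xs ys. \<lbrakk>xs \<in> lists (carrier G); length xs = r; ys \<in> lists (carrier G); length ys = s\<rbrakk> \<Longrightarrow>
        T xs ys = of_nat (order G ^ a * card (matching_solutions G X R us vs xs ys))"
  let ?vs = "take j vs @ vs ! j # vs ! j # drop (Suc j) vs"
  show ?thesis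
  proof (rule solution_countingI[OF fX R us])
    show "?vs \<in> lists X" "length ?vs = Suc s"
      using vs j lists_nth_in[OF vs(1), of j] by (auto dest: in_set_takeD in_set_dropD)
    fix xs ys assume xs: "xs \<in> lists (carrier G)" "length xs = r"
      and ys: "ys \<in> lists (carrier G)" "length ys = Suc s"
    have yj: "ys ! j \<in> carrier G" using lists_nth_in[OF ys(1)] ys(2) j by simp
    let ?ys = "take j ys @ ys ! j # drop (j + 2) ys"
    have "(\<Sum>k\<in>basis (group_algebra G). T xs (take j ys @ k # drop (j + 2) ys) *
          comulc (group_algebra G) k (ys ! j) (ys ! Suc j)) =
        (\<Sum>k\<in>carrier G. of_bool (k = ys ! j) * (T xs (take j ys @ k # drop (j + 2) ys) *
          of_bool (ys ! Suc j = ys ! j)))"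
      by (rule sum.cong) (auto simp: group_algebra_def)
    also have "\<dots> = T xs ?ys * of_bool (ys ! Suc j = ys ! j)"
      using fin yj by (rule sum_of_bool_delta)
    also have "T xs ?ys = of_nat (order G ^ a * card (matching_solutions G X R us vs xs ?ys))"
      using xs ys j yj by (intro T) (auto dest: in_set_takeD in_set_dropD)
    also have "\<dots> * of_bool (ys ! Suc j = ys ! j) =
        of_nat (order G ^ a * card (matching_solutions G X R us ?vs xs ys))"
    proof -
      have "matching_solutions G X R us ?vs xs ys =
          (if ys ! Suc j = ys ! j then matching_solutions G X R us vs xs ?ys else {})"
        using vs(2) ys(2) j
        by (auto simp: matching_solutions_def map_eq_split_iff map_eq_merge_iff
            simp del: map_append list.map)
      then show ?thesis by simp
    qed
    finally show "(\<Sum>k\<in>basis (group_algebra G). T xs (take j ys @ k # drop (j + 2) ys) *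
          comulc (group_algebra G) k (ys ! j) (ys ! Suc j)) =
        of_nat (order G ^ a * card (matching_solutions G X R us ?vs xs ys))" .
  qed
qed

text \<open>
  The delta function at \<open>k\<close> comultiplies to the sum over all factorisations \<open>k = g h\<close>. New
  variables \<open>p\<close> and \<open>q\<close> carry \<open>g\<close> and \<open>h\<close>, and the relator \<open>p q u\<inverse>\<close> forces the old
  variable \<open>u\<close> to be their product. Both new values are prescribed by the indices, so the old
  solutions extend uniquely.
\<close>

lemma solution_counting_comult_dual:
  assumes "solution_counting G r s T" and i: "i < r"
  shows "solution_counting G (Suc r) s (\<lambda>xs ys. \<Sum>k\<in>basis (group_algebra G).
       T (take i xs @ k # drop (i + 2) xs) ys * comulc (dual (group_algebra G)) k (xs ! i) (xs ! Suc i) :: 'k::field_char_0)"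
  using assms(1)
proof (rule solution_countingE)
  fix a and X :: "nat set" and R us vs
  assume fX: "finite X" and R: "finite R" "R \<subseteq> words X"
    and us: "us \<in> lists X" "length us = r" and vs: "vs \<in> lists X" "length vs = s"
    and T: "\<And>xs ys. \<lbrakk>xs \<in> lists (carrier G); length xs = r; ys \<in> lists (carrier G); length ys = s\<rbrakk> \<Longrightarrow>
        T xs ys = of_nat (order G ^ a * card (matching_solutions G X R us vs xs ys))"
  obtain p where p: "p \<notin> X" using ex_new_if_finite[OF infinite_UNIV_nat fX] by blast
  obtain q where "q \<notin> insert p X"
    using ex_new_if_finite[OF infinite_UNIV_nat, of "insert p X"] fX by blast
  then have q: "q \<notin> X" "q \<noteq> p" by auto
  let ?us = "take i us @ p # q # drop (Suc i) us" and ?X = "insert p (insert q X)"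
    and ?R = "insert [(p, True), (q, True), (us ! i, False)] R"
  have ui: "us ! i \<in> X" using lists_nth_in[OF us(1)] us(2) i by simp
  show ?thesis
  proof (rule solution_countingI)
    show "finite ?X" "finite ?R" using fX R by auto
    have "words X \<subseteq> words ?X" unfolding words_def by (intro lists_mono) auto
    then show "?R \<subseteq> words ?X" using R ui by auto
    show "?us \<in> lists ?X" "length ?us = Suc r" "vs \<in> lists ?X" "length vs = s"
      using us vs i by (auto dest: in_set_takeD in_set_dropD)
    fix xs ys assume xs: "xs \<in> lists (carrier G)" "length xs = Suc r"
      and ys: "ys \<in> lists (carrier G)" "length ys = s"
    have xi: "xs ! i \<in> carrier G" "xs ! Suc i \<in> carrier G"
      using lists_nth_in[OF xs(1)] xs(2) i by simp_all
    then have xx: "xs ! i \<otimes> xs ! Suc i \<in> carrier G" by simp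
    let ?xs = "take i xs @ (xs ! i \<otimes> xs ! Suc i) # drop (Suc (Suc i)) xs"
    let ?M = "matching_solutions G X R us vs ?xs ys"
    let ?M' = "matching_solutions G ?X ?R ?us vs xs ys"
    have "(\<Sum>k\<in>basis (group_algebra G). T (take i xs @ k # drop (i + 2) xs) ys *
          comulc (dual (group_algebra G)) k (xs ! i) (xs ! Suc i)) =
        (\<Sum>k\<in>carrier G. T (take i xs @ k # drop (Suc (Suc i)) xs) ys *
          of_bool (k = xs ! i \<otimes> xs ! Suc i))"
      by (simp add: group_algebra_def dual_def)
    also have "\<dots> = T ?xs ys"
      using fin xx by (rule sum_of_bool_delta)
    also have "\<dots> = of_nat (order G ^ a * card ?M)"
      using xs ys i xx by (intro T) (auto dest: in_set_takeD in_set_dropD)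
    also have "card ?M = card ?M'"
    proof (rule bij_betw_same_card)
      have agree: "map \<phi> (take i us) = map \<psi> (take i us)"
          "map \<phi> (drop (Suc i) us) = map \<psi> (drop (Suc i) us)" "map \<phi> vs = map \<psi> vs"
          "\<And>w. w \<in> R \<Longrightarrow> word_value G \<phi> w = word_value G \<psi> w"
        if "\<And>x. x \<in> X \<Longrightarrow> \<phi> x = \<psi> x" for \<phi> \<psi> :: "nat \<Rightarrow> 'g"
        using that us(1) vs(1) R(2)
        by (auto dest: in_set_takeD in_set_dropD intro!: word_value_cong[of _ X])
      show "bij_betw (\<lambda>\<phi>. \<phi>(p := xs ! i, q := xs ! Suc i)) ?M ?M'"
      proof (rule bij_betw_byWitness[where f' = "\<lambda>\<phi>. restrict \<phi> X"])
        show "\<forall>\<phi>\<in>?M. restrict (\<phi>(p := xs ! i, q := xs ! Suc i)) X = \<phi>"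
          using p q by (auto simp: matching_solutions_def solutions_def fun_eq_iff PiE_def extensional_def)
        have m: "\<phi> p = xs ! i \<and> \<phi> q = xs ! Suc i \<and> \<phi> \<in> ?X \<rightarrow>\<^sub>E carrier G" if "\<phi> \<in> ?M'" for \<phi>
          using that us(2) xs(2) i
          by (simp add: matching_solutions_def solutions_def map_eq_split_iff
              del: map_append list.map)
        show "\<forall>\<phi>\<in>?M'. (restrict \<phi> X)(p := xs ! i, q := xs ! Suc i) = \<phi>"
        proof
          fix \<phi> assume "\<phi> \<in> ?M'"
          from m[OF this] show "(restrict \<phi> X)(p := xs ! i, q := xs ! Suc i) = \<phi>"
            by (auto simp: fun_eq_iff PiE_def extensional_def)
        qed
        show "(\<lambda>\<phi>. \<phi>(p := xs ! i, q := xs ! Suc i)) ` ?M \<subseteq> ?M'"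
        proof (rule image_subsetI)
          fix \<phi> assume \<phi>: "\<phi> \<in> ?M"
          let ?\<psi> = "\<phi>(p := xs ! i, q := xs ! Suc i)"
          have eq: "?\<psi> x = \<phi> x" if "x \<in> X" for x using that p q by auto
          note ag = agree[of ?\<psi> \<phi>, OF eq]
          from \<phi> have sol: "\<phi> \<in> X \<rightarrow>\<^sub>E carrier G" "\<And>w. w \<in> R \<Longrightarrow> word_value G \<phi> w = \<one>"
            and m: "map \<phi> (take i us) = take i xs" "\<phi> (us ! i) = xs ! i \<otimes> xs ! Suc i"
              "map \<phi> (drop (Suc i) us) = drop (Suc (Suc i)) xs" "map \<phi> vs = ys"
            using us(2) xs(2) i
            by (simp_all add: matching_solutions_def solutions_def map_eq_merge_iff
                del: map_append list.map)
          have "?\<psi> \<in> ?X \<rightarrow>\<^sub>E carrier G" using sol(1) xi by (auto simp: PiE_def extensional_def)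
          moreover have "word_value G ?\<psi> w = \<one>" if "w \<in> R" for w using ag(4) sol(2) that by simp
          moreover have "word_value G ?\<psi> [(p, True), (q, True), (us ! i, False)] = \<one>"
            using q eq[OF ui] m(2) xi by (simp add: m_assoc[symmetric])
          moreover have "map ?\<psi> ?us = xs"
            using us(2) xs(2) i ag m q
            by (subst map_eq_split_iff) auto
          ultimately show "?\<psi> \<in> ?M'"
            using ag(3) m(4) by (simp add: matching_solutions_def solutions_def)
        qed
        show "(\<lambda>\<phi>. restrict \<phi> X) ` ?M' \<subseteq> ?M"
        proof (rule image_subsetI)
          fix \<phi> assume \<phi>: "\<phi> \<in> ?M'"
          let ?\<psi> = "restrict \<phi> X"
          have eq: "?\<psi> x = \<phi> x" if "x \<in> X" for x using that by auto
          note ag = agree[of ?\<psi> \<phi>, OF eq]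
          from \<phi> have sol: "\<phi> \<in> ?X \<rightarrow>\<^sub>E carrier G" "\<And>w. w \<in> R \<Longrightarrow> word_value G \<phi> w = \<one>"
            and rel: "\<phi> p \<otimes> (\<phi> q \<otimes> (inv (\<phi> (us ! i)) \<otimes> \<one>)) = \<one>"
            and m: "map \<phi> (take i us) = take i xs" "\<phi> p = xs ! i" "\<phi> q = xs ! Suc i"
              "map \<phi> (drop (Suc i) us) = drop (Suc (Suc i)) xs" "map \<phi> vs = ys"
            using us(2) xs(2) i
            by (auto simp add: matching_solutions_def solutions_def map_eq_split_iff
                simp del: map_append)
          have ui': "\<phi> (us ! i) \<in> carrier G" using sol(1) ui by auto
          then have "(xs ! i \<otimes> xs ! Suc i) \<otimes> inv (\<phi> (us ! i)) = \<one>"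
            using rel m xi by (simp add: m_assoc)
          then have "\<phi> (us ! i) = xs ! i \<otimes> xs ! Suc i"
            using ui' xi by (metis inv_closed inv_inv inv_equality m_closed)
          then have "map ?\<psi> us = ?xs"
            using us(2) xs(2) i ag m eq[OF ui] by (subst map_eq_merge_iff) auto
          moreover have "?\<psi> \<in> X \<rightarrow>\<^sub>E carrier G" using sol(1) by auto
          ultimately show "?\<psi> \<in> ?M"
            using ag(3,4) m(5) sol(2) by (simp add: matching_solutions_def solutions_def)
        qed
      qed
    qed
    finally show "(\<Sum>k\<in>basis (group_algebra G). T (take i xs @ k # drop (i + 2) xs) ys *
          comulc (dual (group_algebra G)) k (xs ! i) (xs ! Suc i)) = of_nat (order G ^ a * card ?M')" .
  qed
qed

lemma permute_list_eq_iff: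
  assumes "\<sigma> permutes {..<length xs}" "length zs = length xs"
  shows "zs = permute_list \<sigma> xs \<longleftrightarrow> permute_list (inv_into UNIV \<sigma>) zs = xs"
proof -
  note inv = permutes_inv[OF assms(1)]
  have "permute_list (inv_into UNIV \<sigma>) (permute_list \<sigma> xs) = xs"
    using permute_list_compose[OF inv, of \<sigma>] permutes_inv_o[OF assms(1)] by simp
  moreover have "permute_list \<sigma> (permute_list (inv_into UNIV \<sigma>) zs) = zs"
    using permute_list_compose[of \<sigma> zs "inv_into UNIV \<sigma>"] permutes_inv_o[OF assms(1)] assms by simp
  ultimately show ?thesis by metis
qed

lemma permute_list_in_lists:
  "\<lbrakk>\<sigma> permutes {..<length xs}; xs \<in> lists A\<rbrakk> \<Longrightarrow> permute_list \<sigma> xs \<in> lists A"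
  by (simp add: in_lists_conv_set)

text \<open>Permuting the indices amounts to permuting the list of variables inversely.\<close>

lemma solution_counting_permute_H:
  assumes "solution_counting G r s (T :: ('g, 'k::field) tensor)" and \<sigma>: "\<sigma> permutes {..<s}"
  shows "solution_counting G r s (\<lambda>xs ys. T xs (permute_list \<sigma> ys))"
  using assms(1)
proof (rule solution_countingE)
  fix a and X :: "nat set" and R us vs
  assume fX: "finite X" and R: "finite R" "R \<subseteq> words X"
    and us: "us \<in> lists X" "length us = r" and vs: "vs \<in> lists X" "length vs = s"
    and T: "\<And>xs ys. \<lbrakk>xs \<in> lists (carrier G); length xs = r; ys \<in> lists (carrier G); length ys = s\<rbrakk> \<Longrightarrow>
        T xs ys = of_nat (order G ^ a * card (matching_solutions G X R us vs xs ys))"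
  show ?thesis
  proof (rule solution_countingI[OF fX R us])
    let ?vs = "permute_list (inv_into UNIV \<sigma>) vs"
    show "?vs \<in> lists X" "length ?vs = s"
      using vs permutes_inv[OF \<sigma>] by (simp_all add: permute_list_in_lists del: in_lists_conv_set)
    fix xs ys assume xs: "xs \<in> lists (carrier G)" "length xs = r"
      and ys: "ys \<in> lists (carrier G)" "length ys = s"
    have "matching_solutions G X R us vs xs (permute_list \<sigma> ys) = matching_solutions G X R us ?vs xs ys"
      using \<sigma> ys vs permutes_inv[OF \<sigma>]
      by (simp add: matching_solutions_def permute_list_eq_iff permute_list_map)
    then show "T xs (permute_list \<sigma> ys) = of_nat (order G ^ a * card (matching_solutions G X R us ?vs xs ys))"
      using xs ys \<sigma> by (subst T) (simp_all add: permute_list_in_lists del: in_lists_conv_set)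
  qed
qed

text \<open>
  The counting condition treats the two kinds of factors alike; this reduces permutations of the
  dual factors to those of the factors of the algebra.
\<close>

lemma solution_counting_swap:
  assumes "solution_counting G r s T"
  shows "solution_counting G s r (\<lambda>ys xs. T xs ys)"
  using assms
proof (rule solution_countingE)
  fix a and X :: "nat set" and R us vs
  assume fX: "finite X" and R: "finite R" "R \<subseteq> words X"
    and us: "us \<in> lists X" "length us = r" and vs: "vs \<in> lists X" "length vs = s"
    and T: "\<And>xs ys. \<lbrakk>xs \<in> lists (carrier G); length xs = r; ys \<in> lists (carrier G); length ys = s\<rbrakk> \<Longrightarrow>
        T xs ys = of_nat (order G ^ a * card (matching_solutions G X R us vs xs ys))"
  have "matching_solutions G X R us vs xs ys = matching_solutions G X R vs us ys xs" for xs ys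
    by (auto simp: matching_solutions_def)
  then show ?thesis using T by (intro solution_countingI[OF fX R vs us, of _ _ a]) simp
qed

lemma solution_counting_permute_dual:
  assumes "solution_counting G r s (T :: ('g, 'k::field) tensor)" and \<sigma>: "\<sigma> permutes {..<r}"
  shows "solution_counting G r s (\<lambda>xs ys. T (permute_list \<sigma> xs) ys)"
  using solution_counting_swap[OF solution_counting_permute_H[OF solution_counting_swap[OF assms(1)] \<sigma>]] .

text \<open>
  Pairing dual bases makes the two indices equal and sums over their common value. The
  equality becomes a relator, and the two variables are no longer listed.
\<close>

lemma solution_counting_evaluate:
  assumes "solution_counting G (Suc r) (Suc s) T" and i: "i \<le> r" and j: "j \<le> s"
  shows "solution_counting G r s (\<lambda>xs ys. \<Sum>k\<in>basis (group_algebra G).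
       T (take i xs @ k # drop i xs) (take j ys @ k # drop j ys) :: 'k::field_char_0)"
  using assms(1)
proof (rule solution_countingE)
  fix a and X :: "nat set" and R us vs
  assume fX: "finite X" and R: "finite R" "R \<subseteq> words X"
    and us: "us \<in> lists X" "length us = Suc r" and vs: "vs \<in> lists X" "length vs = Suc s"
    and T: "\<And>xs ys. \<lbrakk>xs \<in> lists (carrier G); length xs = Suc r; ys \<in> lists (carrier G); length ys = Suc s\<rbrakk> \<Longrightarrow>
        T xs ys = of_nat (order G ^ a * card (matching_solutions G X R us vs xs ys))"
  let ?us = "take i us @ drop (Suc i) us" and ?vs = "take j vs @ drop (Suc j) vs"
    and ?R = "insert [(us ! i, True), (vs ! j, False)] R"
  have ui: "us ! i \<in> X" using lists_nth_in[OF us(1)] us(2) i by simp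
  have vj: "vs ! j \<in> X" using lists_nth_in[OF vs(1)] vs(2) j by simp
  show ?thesis
  proof (rule solution_countingI[OF fX])
    show "finite ?R" "?R \<subseteq> words X" using R ui vj by auto
    show "?us \<in> lists X" "length ?us = r" "?vs \<in> lists X" "length ?vs = s"
      using us vs i j by (auto dest: in_set_takeD in_set_dropD)
    fix xs ys assume xs: "xs \<in> lists (carrier G)" "length xs = r"
      and ys: "ys \<in> lists (carrier G)" "length ys = s"
    let ?xs = "\<lambda>k. take i xs @ k # drop i xs" and ?ys = "\<lambda>k. take j ys @ k # drop j ys"
    let ?match = "\<lambda>\<phi> k. map \<phi> us = ?xs k \<and> map \<phi> vs = ?ys k"
    have match: "?match \<phi> k \<longleftrightarrow> k = \<phi> (us ! i) \<and> k = \<phi> (vs ! j) \<and> map \<phi> ?us = xs \<and> map \<phi> ?vs = ys"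
      for \<phi> k
      using us(2) vs(2) xs(2) ys(2) i j
      by (auto simp: map_eq_insert_iff simp del: map_append)
    have "(\<Sum>k\<in>basis (group_algebra G). T (?xs k) (?ys k)) =
        (\<Sum>k\<in>carrier G. of_nat (order G ^ a * card (matching_solutions G X R us vs (?xs k) (?ys k))))"
      using xs ys i j
      by (intro sum.cong T) (auto simp: group_algebra_def dest: in_set_takeD in_set_dropD)
    also have "\<dots> = of_nat (order G ^ a *
        (\<Sum>k\<in>carrier G. card {\<phi> \<in> solutions G X R. ?match \<phi> k}))"
      by (simp add: matching_solutions_def sum_distrib_left)
    also have "(\<Sum>k\<in>carrier G. card {\<phi> \<in> solutions G X R. ?match \<phi> k}) =
        card {\<phi> \<in> solutions G X R. ?match \<phi> (\<phi> (us ! i))}"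
    proof (rule sum_card_fibres[OF fin finite_solutions[OF fX fin]])
      show "\<phi> (us ! i) \<in> carrier G" if "\<phi> \<in> solutions G X R" for \<phi>
        using that ui by (auto simp: solutions_def)
      show "k = \<phi> (us ! i)" if "?match \<phi> k" for \<phi> k using that match by blast
    qed
    also have "{\<phi> \<in> solutions G X R. ?match \<phi> (\<phi> (us ! i))} = matching_solutions G X ?R ?us ?vs xs ys"
    proof -
      have "\<phi> (us ! i) \<otimes> (inv \<phi> (vs ! j) \<otimes> \<one>) = \<one> \<longleftrightarrow> \<phi> (us ! i) = \<phi> (vs ! j)"
        if "\<phi> \<in> X \<rightarrow>\<^sub>E carrier G" for \<phi>
      proof -
        have "\<phi> (us ! i) \<in> carrier G" "\<phi> (vs ! j) \<in> carrier G" using that ui vj by auto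
        then show ?thesis by (metis inv_closed inv_inv inv_equality r_inv r_one)
      qed
      then show ?thesis
        unfolding match by (auto simp: matching_solutions_def solutions_def simp del: map_append)
    qed
    finally show "(\<Sum>k\<in>basis (group_algebra G). T (?xs k) (?ys k)) =
        of_nat (order G ^ a * card (matching_solutions G X ?R ?us ?vs xs ys))" .
  qed
qed

lemma basic_tensor_solution_counting:
  "basic_tensor (group_algebra G :: ('g, 'k::field_char_0) hopf) r s T \<Longrightarrow> solution_counting G r s T"
proof (induction rule: basic_tensor.induct)
  case integrals
  show ?case by (rule solution_counting_integrals)
next
  case comult_H
  then show ?case by (intro solution_counting_comult_H)
next
  case comult_dual
  then show ?case by (intro solution_counting_comult_dual)
next
  case permute_H
  then show ?case by (intro solution_counting_permute_H)
next
  case permute_dual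
  then show ?case by (intro solution_counting_permute_dual)
next
  case evaluate
  then show ?case by (intro solution_counting_evaluate)
qed

end

section \<open>Basic invariants count homomorphisms\<close>

theorem lemma9p1:
  fixes G :: "('g, 'm) monoid_scheme"
    and n :: nat
    and c :: "'k::{alg_closed_field, field_char_0}"
  assumes "group G" and "finite (carrier G)" and "order G = n"
    and "basic_invariant (group_algebra G) c"
  shows "\<exists>(P :: nat word set set monoid) (a :: nat).
    finitely_presented P \<and> c = of_nat (n ^ a * card (homs P G))"
proof -
  obtain T where "basic_tensor (group_algebra G) 0 0 T" and c: "c = T [] []"
    using assms(4) by (auto simp: basic_invariant_def)
  then have "solution_counting G 0 0 T"
    using basic_tensor_solution_counting[OF assms(1,2)] by blast
  then obtain a and X :: "nat set" and R where fX: "finite X" and R: "finite R" "R \<subseteq> words X"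
    and T: "T [] [] = of_nat (order G ^ a * card (matching_solutions G X R [] [] [] []))"
    by (elim solution_countingE) auto
  have "matching_solutions G X R [] [] [] [] = solutions G X R"
    by (simp add: matching_solutions_def)
  then have "c = of_nat (n ^ a * card (homs (presented_group X (relators X R)) G))"
    using c T assms(3) card_homs_presented_group[OF R(2) assms(1)] by simp
  moreover have "finitely_presented (presented_group X (relators X R))"
    using fX R relators_subset[OF R(2)]
    by (intro finitely_presented_presented_group) (simp_all add: relators_def)
  ultimately show ?thesis by blast
qed

end
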